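(* Let $\mathbf X$ and $Y$ be the state process and the CARMA process given by the state-space representation described in the context, with autoregressive and moving average polynomials $a,b$ and driving Lévy process $L$. Suppose that $\mathbb E L(1)=0$ and $\mathbb E|L(1)|^2=\sigma^2<\infty$ and that all eigenvalues of $\mathbf A$ have strictly negative real parts. Let $$Z(T):=\frac1{\sqrt T}\frac{b(0)}{a(0)}\int_0^TdL(t).$$ Then, as $T\to\infty$, $Z(T)$ converges in distribution to $\mathcal N\left(0,\left(\frac{b(0)}{a(0)}\right)^2\sigma^2\right)$, and $\frac1{\sigma^2}\left|\frac{a(0)Z(T)}{b(0)}\right|^2$ converges in distribution to the $\chi^2(1)$ distribution.
   Context: Let $p>q\ge 0$ be integers, $a(z)=z^p+a_1z^{p-1}+\dots+a_p$ and $b(z)=b_0+b_1z+\dots+b_{p-1}z^{p-1}$ polynomials with real coefficients, with $b_q\ne 0$ and $b_j=0$ for $q<j<p$. Let $\mathbf A\in\mathbb R^{p\times p}$ be the companion matrix $$\mathbf A=\begin{pmatrix}0&1&0&\cdots&0\\0&0&1&\cdots&0\\ \vdots&\vdots&\vdots&\ddots&\vdots\\0&0&0&\cdots&1\\-a_p&-a_{p-1}&-a_{p-2}&\cdots&-a_1\end{pmatrix}$$ (with $\mathbf A=-a_1$ if $p=1$), $\mathbf e=[0,\dots,0,1]^T\in\mathbb R^p$, $\mathbf b=[b_0,b_1,\dots,b_{p-1}]^T\in\mathbb R^p$. Let $(L(t))_{t\ge 0}$ be a one-dimensional (real-valued) Lévy process with $L(0)=0$ a.s., on a filtered probability space satisfying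 the usual hypotheses. State-space representation: the $\mathbb R^p$-valued process $\mathbf X$ solves $d\mathbf X(t)=\mathbf A\mathbf X(t)\,dt+\mathbf e\,dL(t)$, i.e. $\mathbf X(t)=e^{\mathbf At}\mathbf X(0)+\int_0^te^{\mathbf A(t-u)}\mathbf e\,dL(u)$ for $t\ge 0$, and the CARMA process is $Y(t)=\mathbf b^T\mathbf X(t)$. *)

theory Defs
  imports "HOL-Probability.Probability" "Jordan_Normal_Form.Char_Poly"
begin

text \<open>
  Processes are functions \<open>real \<Rightarrow> 'a \<Rightarrow> _\<close> whose time argument is only constrained on
  \<open>[0, \<infinity>)\<close>; their values, and those of filtrations, at negative times are irrelevant.
\<close>

section \<open>Levy processes\<close>

locale usual_filtered_prob_space = prob_space M + complete_measure M
  for M :: "'a measure" +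
  fixes F :: "real \<Rightarrow> 'a measure"
  assumes filtration_sub: "\<And>t. 0 \<le> t \<Longrightarrow> subalgebra M (F t)"
    and filtration_mono: "\<And>s t. 0 \<le> s \<Longrightarrow> s \<le> t \<Longrightarrow> sets (F s) \<subseteq> sets (F t)"
    and filtration_right_continuous: "\<And>t. 0 \<le> t \<Longrightarrow> sets (F t) = (\<Inter>s\<in>{t<..}. sets (F s))"
    and filtration_null_sets: "null_sets M \<subseteq> sets (F 0)"

definition cadlag :: "(real \<Rightarrow> real) \<Rightarrow> bool" where
  "cadlag x \<longleftrightarrow>
     (\<forall>t\<ge>0. continuous (at_right t) x) \<and> (\<forall>t>0. \<exists>l. (x \<longlongrightarrow> l) (at_left t))"

locale levy_process = usual_filtered_prob_space M F
  for M :: "'a measure" and F :: "real \<Rightarrow> 'a measure" +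
  fixes L :: "real \<Rightarrow> 'a \<Rightarrow> real"
  assumes adapted: "\<And>t. 0 \<le> t \<Longrightarrow> L t \<in> borel_measurable (F t)"
    and start_zero: "AE \<omega> in M. L 0 \<omega> = 0"
    and independent_increments: "\<And>s t. 0 \<le> s \<Longrightarrow> s \<le> t \<Longrightarrow>
      indep_set (sets (F s)) {(\<lambda>\<omega>. L t \<omega> - L s \<omega>) -` B \<inter> space M | B. B \<in> sets borel}"
    and stationary_increments: "\<And>s h. 0 \<le> s \<Longrightarrow> 0 \<le> h \<Longrightarrow>
      distr M borel (\<lambda>\<omega>. L (s + h) \<omega> - L s \<omega>) = distr M borel (\<lambda>\<omega>. L h \<omega> - L 0 \<omega>)"
    and stochastically_continuous: "\<And>t \<epsilon>. 0 \<le> t \<Longrightarrow> 0 < \<epsilon> \<Longrightarrow>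
      ((\<lambda>s. prob {\<omega> \<in> space M. \<epsilon> < \<bar>L s \<omega> - L t \<omega>\<bar>}) \<longlongrightarrow> 0) (at t within {0..})"
    and cadlag_paths: "AE \<omega> in M. cadlag (\<lambda>t. L t \<omega>)"

text \<open>
  The stochastic integral over \<open>(0, T]\<close> of the constant integrand 1, which is an elementary
  predictable process, is by definition of the integral the increment of the integrator.
\<close>
definition integral_one :: "(real \<Rightarrow> 'a \<Rightarrow> real) \<Rightarrow> real \<Rightarrow> 'a \<Rightarrow> real" where
  "integral_one L T = (\<lambda>\<omega>. L T \<omega> - L 0 \<omega>)"

section \<open>CARMA processes\<close>

text \<open>
  The coefficients \<open>a\<^sub>1, \<dots>, a\<^sub>p\<close> are \<open>\<alpha> 1, \<dots>, \<alpha> p\<close>, and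
  \<open>b\<^sub>0, \<dots>, b\<^sub>p\<^sub>-\<^sub>1\<close> are \<open>\<beta> 0, \<dots>, \<beta> (p - 1)\<close>. Matrix and vector indices start at 0.
\<close>

definition ar_poly :: "nat \<Rightarrow> (nat \<Rightarrow> real) \<Rightarrow> real poly" where
  "ar_poly p \<alpha> = monom 1 p + (\<Sum>k = 1..p. monom (\<alpha> k) (p - k))"

definition ma_poly :: "nat \<Rightarrow> (nat \<Rightarrow> real) \<Rightarrow> real poly" where
  "ma_poly p \<beta> = (\<Sum>j<p. monom (\<beta> j) j)"

definition carma_matrix :: "nat \<Rightarrow> (nat \<Rightarrow> real) \<Rightarrow> real mat" where
  "carma_matrix p \<alpha> = mat p p (\<lambda>(i, j).
     if i + 1 < p then (if j = i + 1 then 1 else 0) else - \<alpha> (p - j))"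

definition noise_vec :: "nat \<Rightarrow> real Matrix.vec" where
  "noise_vec p = unit_vec p (p - 1)"

definition output_vec :: "nat \<Rightarrow> (nat \<Rightarrow> real) \<Rightarrow> real Matrix.vec" where
  "output_vec p \<beta> = Matrix.vec p \<beta>"

text \<open>
  As the noise is additive, the equation \<open>dX = A X dt + e dL\<close> means
  \<open>X(t) = X(0) + \<integral>\<^sub>0\<^sup>t A X(s) ds + e (L(t) - L(0))\<close>, stated here componentwise.
\<close>
locale carma_process = levy_process M F L
  for M :: "'a measure" and F :: "real \<Rightarrow> 'a measure" and L :: "real \<Rightarrow> 'a \<Rightarrow> real" +
  fixes p q :: nat
    and \<alpha> \<beta> :: "nat \<Rightarrow> real"
    and X :: "real \<Rightarrow> 'a \<Rightarrow> real Matrix.vec"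
    and Y :: "real \<Rightarrow> 'a \<Rightarrow> real"
  assumes q_less_p: "q < p"
    and ma_coeff_q: "\<beta> q \<noteq> 0"
    and ma_coeff_zero: "\<And>j. q < j \<Longrightarrow> j < p \<Longrightarrow> \<beta> j = 0"
    and state_dim: "\<And>t \<omega>. 0 \<le> t \<Longrightarrow> \<omega> \<in> space M \<Longrightarrow> X t \<omega> \<in> carrier_vec p"
    and state_measurable:
      "\<And>t i. 0 \<le> t \<Longrightarrow> i < p \<Longrightarrow> (\<lambda>\<omega>. vec_index (X t \<omega>) i) \<in> borel_measurable M"
    and state_equation: "AE \<omega> in M. \<forall>t\<ge>0. \<forall>i<p.
      set_integrable lborel {0..t} (\<lambda>s. vec_index (carma_matrix p \<alpha> *\<^sub>v X s \<omega>) i) \<and>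
      vec_index (X t \<omega>) i = vec_index (X 0 \<omega>) i
        + (LINT s:{0..t}|lborel. vec_index (carma_matrix p \<alpha> *\<^sub>v X s \<omega>) i)
        + vec_index (noise_vec p) i * integral_one L t \<omega>"
    and output_equation: "\<And>t \<omega>. 0 \<le> t \<Longrightarrow> \<omega> \<in> space M \<Longrightarrow>
      Y t \<omega> = scalar_prod (output_vec p \<beta>) (X t \<omega>)"

section \<open>Convergence in distribution\<close>

text \<open>Weak convergence of laws as in \<^const>\<open>weak_conv_m\<close>, along an arbitrary filter.\<close>
definition converges_in_distribution ::
    "'a measure \<Rightarrow> ('b \<Rightarrow> 'a \<Rightarrow> real) \<Rightarrow> real measure \<Rightarrow> 'b filter \<Rightarrow> bool" where
  "converges_in_distribution M Z N G \<longleftrightarrow>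
     (\<forall>x. isCont (cdf N) x \<longrightarrow> ((\<lambda>i. cdf (distr M borel (Z i)) x) \<longlongrightarrow> cdf N x) G)"

lemma converges_in_distribution_sequentially:
  "converges_in_distribution M Z N sequentially \<longleftrightarrow> weak_conv_m (\<lambda>n. distr M borel (Z n)) N"
  by (simp add: converges_in_distribution_def weak_conv_m_def weak_conv_def)

text \<open>
  The second argument is the variance. Variance 0 gives the point mass, whereas
  \<^term>\<open>normal_density m 0\<close> is identically 0 and not a probability density.
\<close>
definition normal_distribution :: "real \<Rightarrow> real \<Rightarrow> real measure" where
  "normal_distribution m v =
     (if v = 0 then return borel m else density lborel (normal_density m (sqrt v)))"

text \<open>The law of the sum of the squares of \<open>k\<close> independent standard normal variables.\<close>
definition chi_square_distribution :: "nat \<Rightarrow> real measure" where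
  "chi_square_distribution k =
     distr (Pi\<^sub>M {..<k} (\<lambda>_. std_normal_distribution)) borel (\<lambda>x. \<Sum>i<k. (x i)\<^sup>2)"

end

theory Submission
  imports Defs "HOL-Real_Asymp.Real_Asymp"
begin

text \<open>
  Write \<open>\<phi>\<^sub>t\<close> for the characteristic function of \<open>L(t) - L(0)\<close>, the increment that \<open>Z(t)\<close> rescales.
  The theorem is the central limit theorem for the random walk \<open>(L(n))\<close>, read along real times.
  Independence and stationarity of the increments say that \<open>\<phi>\<^sub>s\<^sub>+\<^sub>t = \<phi>\<^sub>s \<phi>\<^sub>t\<close>, so with \<open>n = \<lfloor>T\<rfloor>\<close>
  and \<open>r = T - n\<close>,
  \<open>\<phi>\<^sub>T(u / \<surd>T) = \<phi>\<^sub>1(u / \<surd>T)\<^sup>n \<phi>\<^sub>r(u / \<surd>T)\<close>.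
  The first factor tends to \<open>exp(- \<sigma>\<^sup>2 u\<^sup>2 / 2)\<close> by a second order Taylor expansion of \<open>\<phi>\<^sub>1\<close>
  at 0 (\<open>char_power_floor_tendsto\<close>). The second tends to 1, because \<open>\<phi>\<^sub>r(v) \<rightarrow> 1\<close> as
  \<open>v \<rightarrow> 0\<close>, uniformly over the remainders \<open>r\<close> in \<open>[0, 1]\<close>: this follows from stochastic continuity
  by compactness (\<open>char_integral_one_uniform_limit\<close>).
  Levy's continuity theorem turns the limit of characteristic functions into convergence in
  distribution. Working with characteristic functions also treats the degenerate limit, where the
  variance is 0, together with the others.

  For the second claim, \<open>a(0) = a\<^sub>p\<close> is nonzero, since otherwise the companion matrix would have the
  eigenvalue 0, against stability. Hence \<open>a(0) Z(T) / (\<sigma> b(0))\<close> is the normalised increment, which is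
  asymptotically standard normal, and squaring it is a continuous operation that maps the standard
  normal law to \<open>\<chi>\<^sup>2(1)\<close>.
\<close>

section \<open>Convergence in distribution along real time\<close>

text \<open>
  Random variables indexed by real time are only known to be measurable at nonnegative times, so
  the sequences along which laws are compared have to avoid negative times from the first term on.
\<close>

lemma tendsto_at_topI_sequentially_nonneg:
  fixes f :: "real \<Rightarrow> 'b::first_countable_topology"
  assumes f: "\<And>V. (\<And>n. 0 \<le> V n) \<Longrightarrow> filterlim V at_top sequentially \<Longrightarrow> (\<lambda>n. f (V n)) \<longlonglongrightarrow> y"
  shows "(f \<longlongrightarrow> y) at_top"
proof (rule tendsto_at_topI_sequentially)
  fix U :: "nat \<Rightarrow> real"
  assume U: "filterlim U at_top sequentially"
  have ev: "eventually (\<lambda>n. max (U n) 0 = U n) sequentially"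
    using filterlim_at_top_dense[THEN iffD1, OF U, rule_format, of 0]
    by eventually_elim simp
  have "filterlim (\<lambda>n. max (U n) 0) at_top sequentially"
    using U ev by (subst filterlim_cong[OF refl refl ev])
  then have "(\<lambda>n. f (max (U n) 0)) \<longlonglongrightarrow> y"
    by (rule f[rotated]) simp
  then show "(\<lambda>n. f (U n)) \<longlonglongrightarrow> y"
    by (rule Lim_transform_eventually) (use ev in eventually_elim, simp)
qed

text \<open>
  Levy's continuity theorem concerns sequences of laws; it extends to real time because a limit at
  infinity can be tested along sequences.
\<close>

lemma (in prob_space) converges_in_distribution_at_topI:
  fixes Z :: "real \<Rightarrow> 'a \<Rightarrow> real"
  assumes meas: "\<And>T. 0 \<le> T \<Longrightarrow> Z T \<in> borel_measurable M"
    and N: "real_distribution N"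
    and char: "\<And>t. ((\<lambda>T. char (distr M borel (Z T)) t) \<longlongrightarrow> char N t) at_top"
  shows "converges_in_distribution M Z N at_top"
  unfolding converges_in_distribution_def
proof (intro allI impI tendsto_at_topI_sequentially_nonneg)
  fix x and V :: "nat \<Rightarrow> real"
  assume x: "isCont (cdf N) x" and nonneg: "\<And>n. 0 \<le> V n"
    and V: "filterlim V at_top sequentially"
  have "weak_conv_m (\<lambda>n. distr M borel (Z (V n))) N"
  proof (rule levy_continuity)
    show "real_distribution (distr M borel (Z (V n)))" for n
      by (intro real_distribution_distr meas nonneg)
    show "(\<lambda>n. char (distr M borel (Z (V n))) t) \<longlonglongrightarrow> char N t" for t
      by (rule filterlim_compose[OF char V])
  qed (fact N)
  then show "(\<lambda>n. cdf (distr M borel (Z (V n))) x) \<longlonglongrightarrow> cdf N x"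
    using x by (simp add: weak_conv_m_def weak_conv_def)
qed

text \<open>
  The characteristic function of \<open>g(Z)\<close> is the expectation of \<open>exp(i t g(Z))\<close>, a bounded continuous
  function of \<open>Z\<close>. This reduces the continuous mapping theorem below to weak convergence of the
  laws of \<open>Z\<close>.
\<close>

lemma (in prob_space) converges_in_distribution_at_top_char_image:
  fixes Z :: "real \<Rightarrow> 'a \<Rightarrow> real"
  assumes meas: "\<And>T. 0 \<le> T \<Longrightarrow> Z T \<in> borel_measurable M"
    and N: "real_distribution N"
    and conv: "converges_in_distribution M Z N at_top"
    and g: "\<And>x::real. isCont g x"
  shows "((\<lambda>T. char (distr M borel (\<lambda>\<omega>. g (Z T \<omega>))) t) \<longlongrightarrow> char (distr N borel g) t) at_top"
proof (rule tendsto_at_topI_sequentially_nonneg)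
  fix V :: "nat \<Rightarrow> real"
  assume nonneg: "\<And>n. 0 \<le> V n" and V: "filterlim V at_top sequentially"
  interpret N: real_distribution N by fact
  have [measurable]: "g \<in> borel_measurable borel"
    by (intro borel_measurable_continuous_onI continuous_at_imp_continuous_on ballI g)
  have [measurable]: "Z (V n) \<in> borel_measurable M" for n
    by (rule meas[OF nonneg])
  have weak: "weak_conv_m (\<lambda>n. distr M borel (Z (V n))) N"
    unfolding weak_conv_m_def weak_conv_def
  proof (intro allI impI)
    fix x assume "isCont (cdf N) x"
    then have "((\<lambda>T. cdf (distr M borel (Z T)) x) \<longlongrightarrow> cdf N x) at_top"
      using conv by (simp add: converges_in_distribution_def)
    then show "(\<lambda>n. cdf (distr M borel (Z (V n))) x) \<longlonglongrightarrow> cdf N x"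
      by (rule filterlim_compose[OF _ V])
  qed
  have "(\<lambda>n. integral\<^sup>L (distr M borel (Z (V n))) (\<lambda>x. iexp (t * g x)))
      \<longlonglongrightarrow> integral\<^sup>L N (\<lambda>x. iexp (t * g x))"
  proof (rule weak_conv_imp_integral_bdd_continuous_conv[OF _ N weak, where B = 1])
    show "real_distribution (distr M borel (Z (V n)))" for n
      by (rule real_distribution_distr) measurable
    show "isCont (\<lambda>x. iexp (t * g x)) x" for x
      by (intro continuous_intros g)
  qed simp
  then show "(\<lambda>n. char (distr M borel (\<lambda>\<omega>. g (Z (V n) \<omega>))) t) \<longlonglongrightarrow> char (distr N borel g) t"
    by (simp add: char_def integral_distr)
qed

lemma (in prob_space) converges_in_distribution_at_top_continuous_image:
  fixes Z :: "real \<Rightarrow> 'a \<Rightarrow> real"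
  assumes meas: "\<And>T. 0 \<le> T \<Longrightarrow> Z T \<in> borel_measurable M"
    and N: "real_distribution N"
    and conv: "converges_in_distribution M Z N at_top"
    and g: "\<And>x::real. isCont g x"
  shows "converges_in_distribution M (\<lambda>T \<omega>. g (Z T \<omega>)) (distr N borel g) at_top"
proof (rule converges_in_distribution_at_topI)
  interpret N: real_distribution N by fact
  have [measurable]: "g \<in> borel_measurable borel"
    by (intro borel_measurable_continuous_onI continuous_at_imp_continuous_on ballI g)
  show "(\<lambda>\<omega>. g (Z T \<omega>)) \<in> borel_measurable M" if "0 \<le> T" for T
    using meas[OF that] by measurable
  show "real_distribution (distr N borel g)"
    by (rule N.real_distribution_distr) simp
qed (rule converges_in_distribution_at_top_char_image[OF assms])

section \<open>The limit laws\<close>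

lemma std_normal_distribution_scale:
  assumes "0 < s"
  shows "density lborel (normal_density 0 s) = distr std_normal_distribution borel (\<lambda>x. s * x)"
proof -
  interpret N: real_distribution std_normal_distribution by (rule real_dist_normal_dist)
  have "distributed std_normal_distribution lborel (\<lambda>x. x) std_normal_density"
    by (simp add: distributed_def distr_id2)
  from N.normal_density_affine[OF this, of s 0]
  have "distributed std_normal_distribution lborel (\<lambda>x. s * x) (normal_density 0 s)"
    using assms by simp
  then have "density lborel (normal_density 0 s) = distr std_normal_distribution lborel (\<lambda>x. s * x)"
    by (simp add: distributed_def)
  also have "\<dots> = distr std_normal_distribution borel (\<lambda>x. s * x)"
    by (rule distr_cong) auto
  finally show ?thesis .
qed

lemma
  assumes "0 \<le> v"
  shows real_distribution_normal_distribution: "real_distribution (normal_distribution 0 v)"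
    and char_normal_distribution:
      "char (normal_distribution 0 v) t = complex_of_real (exp (- (v * t\<^sup>2) / 2))"
proof -
  interpret N: real_distribution std_normal_distribution by (rule real_dist_normal_dist)
  have pos: "normal_distribution 0 v = distr std_normal_distribution borel (\<lambda>x. sqrt v * x)" if "v \<noteq> 0"
    using assms that std_normal_distribution_scale[of "sqrt v"] by (simp add: normal_distribution_def)
  show "real_distribution (normal_distribution 0 v)"
  proof (cases "v = 0")
    case True
    then show ?thesis
      by (auto simp: normal_distribution_def real_distribution_def real_distribution_axioms_def
          intro!: prob_space_return)
  qed (simp add: pos N.real_distribution_distr)
  show "char (normal_distribution 0 v) t = complex_of_real (exp (- (v * t\<^sup>2) / 2))"
  proof (cases "v = 0")
    case True
    then show ?thesis by (simp add: normal_distribution_def char_def integral_return)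
  next
    case False
    have "char (normal_distribution 0 v) t = char std_normal_distribution (t * sqrt v)"
      by (simp add: pos[OF False] char_def integral_distr mult.assoc)
    also have "\<dots> = complex_of_real (exp (- (v * t\<^sup>2) / 2))"
      using assms by (simp add: char_std_normal_distribution power_mult_distrib mult.commute)
    finally show ?thesis .
  qed
qed

text \<open>
  The product of a single factor is identified with that factor by its only coordinate.
\<close>

lemma chi_square_distribution_1:
  "chi_square_distribution 1 = distr (normal_distribution 0 1) borel (\<lambda>x. x\<^sup>2)"
proof -
  interpret N: real_distribution std_normal_distribution by (rule real_dist_normal_dist)
  interpret P: product_prob_space "\<lambda>_::nat. std_normal_distribution" "{..<1}" ..
  have [measurable]: "(\<lambda>x. x 0) \<in> measurable (Pi\<^sub>M {..<1::nat} (\<lambda>_. std_normal_distribution)) std_normal_distribution"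
    by (rule measurable_component_singleton) simp
  have "chi_square_distribution 1 =
      distr (distr (Pi\<^sub>M {..<1::nat} (\<lambda>_. std_normal_distribution)) std_normal_distribution (\<lambda>x. x 0))
        borel (\<lambda>x. x\<^sup>2)"
    unfolding chi_square_distribution_def by (subst distr_distr) (auto simp: comp_def lessThan_Suc)
  also have "\<dots> = distr (normal_distribution 0 1) borel (\<lambda>x. x\<^sup>2)"
    by (subst P.PiM_component) (auto simp: normal_distribution_def)
  finally show ?thesis .
qed

section \<open>Characteristic functions of the increments\<close>

context levy_process
begin

lemma borel_measurable_L: "0 \<le> t \<Longrightarrow> L t \<in> borel_measurable M"
  using adapted filtration_sub measurable_from_subalg by blast

lemma borel_measurable_integral_one: "0 \<le> t \<Longrightarrow> integral_one L t \<in> borel_measurable M"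
  unfolding integral_one_def by (intro borel_measurable_diff borel_measurable_L) auto

lemma real_distribution_integral_one:
  "0 \<le> t \<Longrightarrow> real_distribution (distr M borel (integral_one L t))"
  by (intro real_distribution_distr borel_measurable_integral_one)

text \<open>
  The increment up to time \<open>s\<close> is measurable with respect to the \<open>\<sigma>\<close>-algebra of time \<open>s\<close>, and the next
  increment is independent of everything in that \<open>\<sigma>\<close>-algebra.
\<close>

lemma indep_var_consecutive_increments:
  assumes "0 \<le> s" "0 \<le> h"
  shows "indep_var borel (integral_one L s) borel (\<lambda>\<omega>. L (s + h) \<omega> - L s \<omega>)"
proof -
  have [measurable]: "L s \<in> borel_measurable M" "L (s + h) \<in> borel_measurable M"
    using assms by (auto intro!: borel_measurable_L)
  have sub: "subalgebra M (F s)"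
    using assms by (simp add: filtration_sub)
  have "sets (F 0) \<subseteq> sets (F s)"
    using assms by (intro filtration_mono) auto
  moreover have "space (F 0) = space (F s)"
    using filtration_sub[of 0] sub by (simp add: subalgebra_def)
  ultimately have "subalgebra (F s) (F 0)"
    by (simp add: subalgebra_def)
  then have "L 0 \<in> borel_measurable (F s)"
    using adapted[of 0] measurable_from_subalg by blast
  then have past: "integral_one L s \<in> borel_measurable (F s)"
    unfolding integral_one_def using adapted[of s] assms by simp
  have past_sets: "sigma_sets (space M) {integral_one L s -` B \<inter> space M | B. B \<in> sets borel} \<subseteq> sets (F s)"
  proof -
    have sp: "space M = space (F s)"
      using sub by (simp add: subalgebra_def)
    show ?thesis
      unfolding sp by (rule sets.sigma_sets_subset) (use measurable_sets[OF past] in auto)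
  qed
  have future_sets: "sigma_sets (space M) {(\<lambda>\<omega>. L (s + h) \<omega> - L s \<omega>) -` B \<inter> space M | B. B \<in> sets borel} =
      {(\<lambda>\<omega>. L (s + h) \<omega> - L s \<omega>) -` B \<inter> space M | B. B \<in> sets borel}"
    using sets_vimage_algebra[of "space M" "\<lambda>\<omega>. L (s + h) \<omega> - L s \<omega>" borel]
      sets_vimage_algebra2[of "\<lambda>\<omega>. L (s + h) \<omega> - L s \<omega>" "space M" borel] by simp
  have "indep_set (sets (F s)) {(\<lambda>\<omega>. L (s + h) \<omega> - L s \<omega>) -` B \<inter> space M | B. B \<in> sets borel}"
    using assms by (intro independent_increments) auto
  then have "indep_set (sigma_sets (space M) {integral_one L s -` B \<inter> space M | B. B \<in> sets borel})
      {(\<lambda>\<omega>. L (s + h) \<omega> - L s \<omega>) -` B \<inter> space M | B. B \<in> sets borel}"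
    unfolding indep_set_def
    by (rule indep_sets_mono_sets) (use past_sets in \<open>auto split: bool.split\<close>)
  then show ?thesis
    unfolding indep_var_eq future_sets
    using assms by (auto intro!: borel_measurable_integral_one)
qed

lemma char_integral_one_add:
  assumes "0 \<le> s" "0 \<le> h"
  shows "char (distr M borel (integral_one L (s + h))) u =
    char (distr M borel (integral_one L s)) u * char (distr M borel (integral_one L h)) u"
proof -
  have "integral_one L (s + h) = (\<lambda>\<omega>. integral_one L s \<omega> + (L (s + h) \<omega> - L s \<omega>))"
    by (simp add: integral_one_def fun_eq_iff)
  then have "char (distr M borel (integral_one L (s + h))) u =
      char (distr M borel (integral_one L s)) u * char (distr M borel (\<lambda>\<omega>. L (s + h) \<omega> - L s \<omega>)) u"
    by (simp add: char_distr_add[OF indep_var_consecutive_increments[OF assms]])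
  also have "distr M borel (\<lambda>\<omega>. L (s + h) \<omega> - L s \<omega>) = distr M borel (integral_one L h)"
    using stationary_increments[OF assms] by (simp add: integral_one_def)
  finally show ?thesis .
qed

lemma char_integral_one_of_nat:
  "char (distr M borel (integral_one L (real n))) u = char (distr M borel (integral_one L 1)) u ^ n"
proof (induction n)
  case 0
  show ?case by (simp add: integral_one_def char_def integral_distr prob_space del: distr_const)
next
  case (Suc n)
  have "char (distr M borel (integral_one L (real (Suc n)))) u =
      char (distr M borel (integral_one L (real n + 1))) u"
    by (simp add: add.commute)
  also have "\<dots> = char (distr M borel (integral_one L 1)) u ^ Suc n"
    by (subst char_integral_one_add) (simp_all add: Suc)
  finally show ?case .
qed

text \<open>
  The two exponentials differ by at most \<open>\<bar>u\<bar> \<epsilon>\<close> where the increments are \<open>\<epsilon>\<close>-close, and by at most 2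
  elsewhere. Thus stochastic continuity makes the characteristic function continuous in time, with a
  modulus that degrades only linearly in \<open>u\<close>.
\<close>

lemma char_integral_one_diff_le:
  assumes "0 \<le> r" "0 \<le> s" "0 \<le> \<epsilon>"
  shows "cmod (char (distr M borel (integral_one L s)) u - char (distr M borel (integral_one L r)) u)
    \<le> \<bar>u\<bar> * \<epsilon> + 2 * prob {\<omega> \<in> space M. \<epsilon> < \<bar>L s \<omega> - L r \<omega>\<bar>}"
proof -
  have [measurable]: "L s \<in> borel_measurable M" "L r \<in> borel_measurable M"
    "integral_one L s \<in> borel_measurable M" "integral_one L r \<in> borel_measurable M"
    using assms by (auto intro!: borel_measurable_L borel_measurable_integral_one)
  define B where "B = {\<omega> \<in> space M. \<epsilon> < \<bar>L s \<omega> - L r \<omega>\<bar>}"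
  have [measurable]: "B \<in> sets M" unfolding B_def by measurable
  let ?d = "\<lambda>\<omega>. iexp (u * integral_one L s \<omega>) - iexp (u * integral_one L r \<omega>)"
  have int: "integrable M (\<lambda>\<omega>. iexp (u * integral_one L s \<omega>))"
    "integrable M (\<lambda>\<omega>. iexp (u * integral_one L r \<omega>))"
    by (intro integrable_iexp; simp)+
  have bound: "cmod (?d \<omega>) \<le> \<bar>u\<bar> * \<epsilon> + 2 * indicator B \<omega>" if "\<omega> \<in> space M" for \<omega>
  proof (cases "\<omega> \<in> B")
    case True
    have "cmod (?d \<omega>) \<le> cmod (iexp (u * integral_one L s \<omega>)) + cmod (iexp (u * integral_one L r \<omega>))"
      by (rule norm_triangle_ineq4)
    also have "\<dots> = 2" by (simp del: of_real_mult)
    finally show ?thesis using True assms by (simp add: add_increasing)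
  next
    case False
    have "u * integral_one L s \<omega> = u * integral_one L r \<omega> + u * (L s \<omega> - L r \<omega>)"
      by (simp add: integral_one_def algebra_simps)
    then have "?d \<omega> = iexp (u * integral_one L r \<omega>) * (iexp (u * (L s \<omega> - L r \<omega>)) - 1)"
      by (simp only: of_real_add distrib_left exp_add right_diff_distrib mult_1_right)
    then have "cmod (?d \<omega>) = cmod (iexp (u * (L s \<omega> - L r \<omega>)) - 1)"
      by (simp add: norm_mult del: of_real_mult of_real_diff)
    also have "\<dots> \<le> \<bar>u * (L s \<omega> - L r \<omega>)\<bar>"
      using iexp_approx1[of "u * (L s \<omega> - L r \<omega>)" 0] by simp
    also have "\<dots> \<le> \<bar>u\<bar> * \<epsilon>"
      using False that by (auto simp: abs_mult B_def intro!: mult_left_mono)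
    finally show ?thesis using False by simp
  qed
  have "char (distr M borel (integral_one L s)) u - char (distr M borel (integral_one L r)) u
      = (CLINT \<omega>|M. ?d \<omega>)"
    using int by (simp add: char_def integral_distr)
  also have "cmod \<dots> \<le> (LINT \<omega>|M. cmod (?d \<omega>))"
    by (rule integral_norm_bound)
  also have "\<dots> \<le> (LINT \<omega>|M. \<bar>u\<bar> * \<epsilon> + 2 * indicator B \<omega>)"
  proof (intro integral_mono bound)
    show "integrable M (\<lambda>\<omega>. cmod (?d \<omega>))"
      by (intro integrable_norm Bochner_Integration.integrable_diff int)
    show "integrable M (\<lambda>\<omega>. \<bar>u\<bar> * \<epsilon> + 2 * indicator B \<omega>)"
      by (simp add: less_top[symmetric])
  qed
  also have "\<dots> = \<bar>u\<bar> * \<epsilon> + 2 * prob B"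
    by (subst Bochner_Integration.integral_add) (auto simp: prob_space less_top[symmetric])
  finally show ?thesis by (simp add: B_def)
qed

text \<open>
  Near a fixed time \<open>r\<close> all increments have characteristic functions close to that of time \<open>r\<close>, which
  is continuous with value 1 at 0. So each time has a neighbourhood on which the limit is uniform, and
  finitely many of these cover the compact interval.
\<close>

lemma char_integral_one_uniform_limit:
  assumes "0 < \<eta>"
  shows "eventually (\<lambda>u. \<forall>r\<in>{0..1}. cmod (char (distr M borel (integral_one L r)) u - 1) < \<eta>) (nhds 0)"
proof -
  have local: "\<exists>U. open U \<and> r \<in> U \<and>
      eventually (\<lambda>u. \<forall>s\<in>U \<inter> {0..}. cmod (char (distr M borel (integral_one L s)) u - 1) < \<eta>) (nhds 0)"
    if r: "0 \<le> r" for r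
  proof -
    interpret R: real_distribution "distr M borel (integral_one L r)"
      by (rule real_distribution_integral_one[OF r])
    \<comment> \<open>The error \<open>\<eta>\<close> is split into \<open>\<bar>u\<bar> < \<eta>/3\<close> from times with 1-close values, \<open>2 \<eta>/6\<close> from the
      exceptional event, and \<open>\<eta>/3\<close> from the continuity of the characteristic function at time \<open>r\<close>.\<close>
    have "eventually (\<lambda>s. prob {\<omega> \<in> space M. 1 < \<bar>L s \<omega> - L r \<omega>\<bar>} < \<eta> / 6) (at r within {0..})"
      by (rule order_tendstoD(2)[OF stochastically_continuous[OF r]]) (use assms in auto)
    then obtain U where U: "open U" "r \<in> U"
        "\<And>s. s \<in> U \<Longrightarrow> s \<noteq> r \<Longrightarrow> 0 \<le> s \<Longrightarrow> prob {\<omega> \<in> space M. 1 < \<bar>L s \<omega> - L r \<omega>\<bar>} < \<eta> / 6"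
      unfolding eventually_at_topological by auto
    have close: "prob {\<omega> \<in> space M. 1 < \<bar>L s \<omega> - L r \<omega>\<bar>} < \<eta> / 6" if "s \<in> U" "0 \<le> s" for s
      using U(3)[of s] that assms by (cases "s = r") auto
    have "((\<lambda>u. char (distr M borel (integral_one L r)) u) \<longlongrightarrow> 1) (nhds 0)"
      using R.isCont_char[of 0] R.char_zero by (simp add: continuous_within tendsto_nhds_iff)
    then have "eventually (\<lambda>u. cmod (char (distr M borel (integral_one L r)) u - 1) < \<eta> / 3) (nhds 0)"
      using assms by (auto simp: tendsto_iff dist_norm dest: spec[of _ "\<eta> / 3"])
    moreover have "eventually (\<lambda>u::real. \<bar>u\<bar> < \<eta> / 3) (nhds 0)"
      using assms by (auto simp: eventually_nhds_metric dist_real_def intro!: exI[of _ "\<eta> / 3"])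
    ultimately have "eventually (\<lambda>u. \<forall>s\<in>U \<inter> {0..}.
        cmod (char (distr M borel (integral_one L s)) u - 1) < \<eta>) (nhds 0)"
    proof eventually_elim
      case (elim u)
      show ?case
      proof safe
        fix s :: real assume s: "s \<in> U" "0 \<le> s"
        have "cmod (char (distr M borel (integral_one L s)) u - 1)
            \<le> cmod (char (distr M borel (integral_one L s)) u - char (distr M borel (integral_one L r)) u)
              + cmod (char (distr M borel (integral_one L r)) u - 1)"
          using norm_triangle_ineq[of "char (distr M borel (integral_one L s)) u
              - char (distr M borel (integral_one L r)) u" "char (distr M borel (integral_one L r)) u - 1"]
          by simp
        also have "\<dots> < \<eta>"
          using char_integral_one_diff_le[OF r s(2), of 1 u] close[OF s] elim by simp
        finally show "cmod (char (distr M borel (integral_one L s)) u - 1) < \<eta>" .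
      qed
    qed
    with U show ?thesis by blast
  qed
  then have "\<forall>r\<in>{0..1}. \<exists>U. open U \<and> r \<in> U \<and>
      eventually (\<lambda>u. \<forall>s\<in>U \<inter> {0..}. cmod (char (distr M borel (integral_one L s)) u - 1) < \<eta>) (nhds 0)"
    by simp
  from bchoice[OF this] obtain U where U: "\<forall>r\<in>{0..1}. open (U r) \<and> r \<in> U r \<and>
      eventually (\<lambda>u. \<forall>s\<in>U r \<inter> {0..}. cmod (char (distr M borel (integral_one L s)) u - 1) < \<eta>) (nhds 0)"
    ..
  obtain C where C: "C \<subseteq> {0..1::real}" "finite C" "{0..1} \<subseteq> (\<Union>r\<in>C. U r)"
  proof (rule compactE_image[OF compact_Icc, of "{0..1}" U 0 1])
    show "{0..1} \<subseteq> (\<Union>r\<in>{0..1}. U r)"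
      using U by blast
  qed (use U in auto)
  have "eventually (\<lambda>u. \<forall>r\<in>C. \<forall>s\<in>U r \<inter> {0..}.
      cmod (char (distr M borel (integral_one L s)) u - 1) < \<eta>) (nhds 0)"
    using C(1,2) U by (intro eventually_ball_finite) auto
  then show ?thesis
  proof eventually_elim
    case (elim u)
    show ?case
    proof
      fix r :: real assume r: "r \<in> {0..1}"
      with C(3) obtain c where "c \<in> C" "r \<in> U c" by blast
      with elim r show "cmod (char (distr M borel (integral_one L r)) u - 1) < \<eta>" by simp
    qed
  qed
qed

end

section \<open>The central limit theorem for the increments\<close>

text \<open>
  The exponent and the scaling are driven by the same real parameter. Since \<open>\<bar>x\<^sup>n - y\<^sup>n\<bar> \<le> n \<bar>x - y\<bar>\<close> on the unit disc, the characteristic function may be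
  replaced by its second order Taylor polynomial \<open>1 - d / T\<close>, at the cost of \<open>n \<le> T\<close> times a remainder
  of order \<open>o(1 / T)\<close>. The mean square \<open>v\<close> may be 0.
\<close>

lemma (in real_distribution) char_power_floor_tendsto:
  assumes 1: "integrable M (\<lambda>x. x)" "expectation (\<lambda>x. x) = 0"
    and 2: "integrable M (\<lambda>x. x\<^sup>2)" "expectation (\<lambda>x. x\<^sup>2) = v"
  shows "((\<lambda>T. char M (u / sqrt T) ^ nat \<lfloor>T\<rfloor>) \<longlongrightarrow> complex_of_real (exp (- (v * u\<^sup>2) / 2))) at_top"
proof -
  define d where "d = v * u\<^sup>2 / 2"
  have v: "0 \<le> v" using 2(2) by auto
  then have d: "0 \<le> d" by (simp add: d_def)
  define R where "R T = expectation (\<lambda>x. min (6 * x\<^sup>2) (\<bar>u / sqrt T\<bar> * \<bar>x\<bar> ^ 3))" for T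
  have R: "(R \<longlongrightarrow> 0) at_top"
  proof -
    have "((\<lambda>T. expectation (\<lambda>x. min (6 * x\<^sup>2) (\<bar>u / sqrt T\<bar> * \<bar>x\<bar> ^ 3))) \<longlongrightarrow> expectation (\<lambda>x. 0)) at_top"
    proof (rule integral_dominated_convergence_at_top[where w = "\<lambda>x. 6 * x\<^sup>2"])
      show "AE x in M. ((\<lambda>T. min (6 * x\<^sup>2) (\<bar>u / sqrt T\<bar> * \<bar>x\<bar> ^ 3)) \<longlongrightarrow> 0) at_top"
      proof (rule AE_I2)
        fix x
        have "((\<lambda>T. \<bar>u / sqrt T\<bar> * \<bar>x\<bar> ^ 3) \<longlongrightarrow> \<bar>0\<bar> * \<bar>x\<bar> ^ 3) at_top"
          by (intro tendsto_intros tendsto_divide_0[OF tendsto_const]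
              filterlim_at_top_imp_at_infinity sqrt_at_top)
        from tendsto_min[OF tendsto_const this, of "6 * x\<^sup>2"]
        show "((\<lambda>T. min (6 * x\<^sup>2) (\<bar>u / sqrt T\<bar> * \<bar>x\<bar> ^ 3)) \<longlongrightarrow> 0) at_top"
          by simp
      qed
    qed (use 2 in auto)
    then show ?thesis by (simp add: R_def[abs_def])
  qed
  \<comment> \<open>For \<open>T \<ge> d\<close> the number \<open>1 - d / T\<close> lies in the unit disc.\<close>
  have "eventually (\<lambda>T. cmod (char M (u / sqrt T) ^ nat \<lfloor>T\<rfloor> - complex_of_real ((1 - d / T) ^ nat \<lfloor>T\<rfloor>))
      \<le> u\<^sup>2 / 6 * R T) at_top"
    using eventually_ge_at_top[of "max 1 d"]
  proof eventually_elim
    case (elim T)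
    then have T: "1 \<le> T" "d \<le> T" by auto
    let ?n = "nat \<lfloor>T\<rfloor>"
    have n: "real ?n \<le> T" using T by linarith
    have sq: "(u / sqrt T)\<^sup>2 = u\<^sup>2 / T" using T by (simp add: power_divide)
    have step: "cmod (char M (u / sqrt T) - (1 - d / T)) \<le> u\<^sup>2 / T / 6 * R T"
      using char_approx3[of v "u / sqrt T"] 1 2 by (simp add: R_def sq d_def mult.commute)
    have "0 \<le> d / T" "d / T \<le> 1" using T d by (auto simp: divide_le_eq)
    then have "cmod (char M (u / sqrt T) ^ ?n - complex_of_real (1 - d / T) ^ ?n)
        \<le> ?n * cmod (char M (u / sqrt T) - complex_of_real (1 - d / T))"
      by (intro norm_power_diff cmod_char_le_1) (simp_all del: of_real_diff of_real_divide)
    also have "\<dots> \<le> T * (u\<^sup>2 / T / 6 * R T)"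
      using n step T by (intro mult_mono) auto
    also have "\<dots> = u\<^sup>2 / 6 * R T" using T by simp
    finally show ?case by simp
  qed
  moreover have "((\<lambda>T. u\<^sup>2 / 6 * R T) \<longlongrightarrow> 0) at_top"
    by (rule tendsto_mult_right_zero[OF R])
  ultimately have diff: "((\<lambda>T. char M (u / sqrt T) ^ nat \<lfloor>T\<rfloor> - complex_of_real ((1 - d / T) ^ nat \<lfloor>T\<rfloor>)) \<longlongrightarrow> 0) at_top"
    by (rule Lim_null_comparison)
  have "((\<lambda>T. (1 - d / T) powr real_of_int \<lfloor>T\<rfloor>) \<longlongrightarrow> exp (- d)) at_top"
  proof (cases "d = 0")
    case False
    with d have "0 < d" by simp
    then show ?thesis by real_asymp
  qed simp
  moreover have "eventually (\<lambda>T. (1 - d / T) powr real_of_int \<lfloor>T\<rfloor> = (1 - d / T) ^ nat \<lfloor>T\<rfloor>) at_top"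
    using eventually_gt_at_top[of "max 1 d"]
  proof eventually_elim
    case (elim T)
    then have "0 < 1 - d / T" "real_of_int \<lfloor>T\<rfloor> = real (nat \<lfloor>T\<rfloor>)" by auto
    then show ?case by (simp only: powr_realpow)
  qed
  ultimately have "((\<lambda>T. (1 - d / T) ^ nat \<lfloor>T\<rfloor>) \<longlongrightarrow> exp (- d)) at_top"
    by (rule Lim_transform_eventually)
  then have "((\<lambda>T. complex_of_real ((1 - d / T) ^ nat \<lfloor>T\<rfloor>)) \<longlongrightarrow> complex_of_real (exp (- d))) at_top"
    by (rule tendsto_of_real)
  from tendsto_add[OF diff this] show ?thesis
    by (simp add: d_def)
qed

text \<open>
  Time \<open>T\<close> is split at its integer part: the integer part produces the Gaussian limit, and the
  fractional part contributes a factor tending to 1.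
\<close>

lemma (in levy_process) char_integral_one_scaled_tendsto:
  assumes 1: "integrable M (L 1)" "expectation (L 1) = 0"
    and 2: "integrable M (\<lambda>\<omega>. (L 1 \<omega>)\<^sup>2)" "expectation (\<lambda>\<omega>. (L 1 \<omega>)\<^sup>2) = v"
  shows "((\<lambda>T. char (distr M borel (integral_one L T)) (u / sqrt T))
    \<longlongrightarrow> complex_of_real (exp (- (v * u\<^sup>2) / 2))) at_top"
proof -
  have [measurable]: "L 0 \<in> borel_measurable M" "L 1 \<in> borel_measurable M"
      "integral_one L 1 \<in> borel_measurable M"
    by (auto intro: borel_measurable_L borel_measurable_integral_one)
  interpret D: real_distribution "distr M borel (integral_one L 1)"
    by (rule real_distribution_integral_one) simp
  have eq: "distr M borel (integral_one L 1) = distr M borel (L 1)"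
    using start_zero by (intro distr_cong_AE) (auto simp: integral_one_def)
  have whole: "((\<lambda>T. char (distr M borel (integral_one L 1)) (u / sqrt T) ^ nat \<lfloor>T\<rfloor>)
      \<longlongrightarrow> complex_of_real (exp (- (v * u\<^sup>2) / 2))) at_top"
    by (rule D.char_power_floor_tendsto)
      (use 1 2 in \<open>simp_all add: eq integrable_distr_eq integral_distr\<close>)
  have rest: "((\<lambda>T. char (distr M borel (integral_one L (T - real_of_int \<lfloor>T\<rfloor>))) (u / sqrt T)) \<longlongrightarrow> 1) at_top"
  proof (rule tendstoI)
    fix \<eta> :: real assume "0 < \<eta>"
    have "((\<lambda>T. u / sqrt T) \<longlongrightarrow> 0) at_top"
      by (intro tendsto_divide_0[OF tendsto_const] filterlim_at_top_imp_at_infinity sqrt_at_top)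
    from filterlim_iff[THEN iffD1, OF this, rule_format, OF char_integral_one_uniform_limit[OF \<open>0 < \<eta>\<close>]]
    show "eventually (\<lambda>T. dist (char (distr M borel (integral_one L (T - real_of_int \<lfloor>T\<rfloor>))) (u / sqrt T)) 1 < \<eta>) at_top"
    proof eventually_elim
      case (elim T)
      have "T - real_of_int \<lfloor>T\<rfloor> \<in> {0..1}"
        using floor_correct[of T] by (auto simp: algebra_simps)
      with elim show ?case by (simp add: dist_norm)
    qed
  qed
  have "eventually (\<lambda>T. char (distr M borel (integral_one L 1)) (u / sqrt T) ^ nat \<lfloor>T\<rfloor>
        * char (distr M borel (integral_one L (T - real_of_int \<lfloor>T\<rfloor>))) (u / sqrt T)
      = char (distr M borel (integral_one L T)) (u / sqrt T)) at_top"
    using eventually_ge_at_top[of 0]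
  proof eventually_elim
    case (elim T)
    then have "real (nat \<lfloor>T\<rfloor>) = real_of_int \<lfloor>T\<rfloor>" by simp
    then show ?case
      using char_integral_one_add[of "real (nat \<lfloor>T\<rfloor>)" "T - real_of_int \<lfloor>T\<rfloor>" "u / sqrt T"]
        char_integral_one_of_nat[of "nat \<lfloor>T\<rfloor>" "u / sqrt T"] by simp
  qed
  from Lim_transform_eventually[OF tendsto_mult[OF whole rest] this] show ?thesis
    by (simp only: mult_1_right)
qed

lemma (in levy_process) levy_central_limit_theorem:
  assumes 1: "integrable M (L 1)" "expectation (L 1) = 0"
    and 2: "integrable M (\<lambda>\<omega>. (L 1 \<omega>)\<^sup>2)" "expectation (\<lambda>\<omega>. (L 1 \<omega>)\<^sup>2) = v"
  shows "converges_in_distribution M (\<lambda>T \<omega>. 1 / sqrt T * c * integral_one L T \<omega>)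
    (normal_distribution 0 (c\<^sup>2 * v)) at_top"
proof (rule converges_in_distribution_at_topI)
  have v: "0 \<le> c\<^sup>2 * v" using 2(2) by auto
  show "(\<lambda>\<omega>. 1 / sqrt T * c * integral_one L T \<omega>) \<in> borel_measurable M" if "0 \<le> T" for T
    using borel_measurable_integral_one[OF that] by simp
  show "real_distribution (normal_distribution 0 (c\<^sup>2 * v))"
    by (rule real_distribution_normal_distribution[OF v])
  fix t
  have "((\<lambda>T. char (distr M borel (integral_one L T)) (t * c / sqrt T))
      \<longlongrightarrow> complex_of_real (exp (- (v * (t * c)\<^sup>2) / 2))) at_top"
    by (rule char_integral_one_scaled_tendsto[OF assms])
  also have "complex_of_real (exp (- (v * (t * c)\<^sup>2) / 2)) = char (normal_distribution 0 (c\<^sup>2 * v)) t"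
    unfolding char_normal_distribution[OF v] by (simp add: power_mult_distrib mult_ac)
  finally have lim: "((\<lambda>T. char (distr M borel (integral_one L T)) (t * c / sqrt T))
      \<longlongrightarrow> char (normal_distribution 0 (c\<^sup>2 * v)) t) at_top" .
  have "eventually (\<lambda>T. char (distr M borel (integral_one L T)) (t * c / sqrt T)
      = char (distr M borel (\<lambda>\<omega>. 1 / sqrt T * c * integral_one L T \<omega>)) t) at_top"
    using eventually_ge_at_top[of 0]
  proof eventually_elim
    case (elim T)
    note [measurable] = borel_measurable_integral_one[OF elim]
    show ?case by (simp add: char_def integral_distr field_simps)
  qed
  then show "((\<lambda>T. char (distr M borel (\<lambda>\<omega>. 1 / sqrt T * c * integral_one L T \<omega>)) t)
      \<longlongrightarrow> char (normal_distribution 0 (c\<^sup>2 * v)) t) at_top"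
    by (rule Lim_transform_eventually[OF lim])
qed

section \<open>The zero eigenvalue\<close>

lemma poly_ar_poly_0:
  assumes "0 < p"
  shows "poly (ar_poly p \<alpha>) 0 = \<alpha> p"
proof -
  have "poly (ar_poly p \<alpha>) 0 = (\<Sum>k = 1..p. \<alpha> k * 0 ^ (p - k))"
    using assms by (simp add: ar_poly_def poly_sum poly_monom)
  also have "\<dots> = (\<Sum>k = 1..p. if k = p then \<alpha> k else 0)"
    by (intro sum.cong) (auto simp: power_0_left)
  also have "\<dots> = \<alpha> p"
    using assms by simp
  finally show ?thesis .
qed

text \<open>
  The first column of the companion matrix has \<open>- \<alpha> p\<close> as its only entry that can be nonzero, so
  the first unit vector lies in the kernel when \<open>\<alpha> p\<close> vanishes.
\<close>

lemma eigenvalue_carma_matrix_0: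
  assumes p: "0 < p" and \<alpha>: "\<alpha> p = 0"
  shows "eigenvalue (map_mat complex_of_real (carma_matrix p \<alpha>)) 0"
proof -
  let ?A = "map_mat complex_of_real (carma_matrix p \<alpha>)" and ?e = "unit_vec p 0 :: complex Matrix.vec"
  have "?A *\<^sub>v ?e = 0\<^sub>v p"
  proof (rule eq_vecI)
    fix i assume "i < dim_vec (0\<^sub>v p :: complex Matrix.vec)"
    then have i: "i < p" by simp
    then have "vec_index (?A *\<^sub>v ?e) i = ?A $$ (i, 0)"
      using p by (simp add: carma_matrix_def scalar_prod_right_unit)
    also have "\<dots> = 0"
      using i p \<alpha> by (simp add: carma_matrix_def)
    finally show "vec_index (?A *\<^sub>v ?e) i = vec_index (0\<^sub>v p) i"
      using i by simp
  qed (simp add: carma_matrix_def)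
  moreover have "?e \<noteq> 0\<^sub>v p"
    using p by (metis index_unit_vec(1) index_zero_vec(1) zero_neq_one)
  ultimately show ?thesis
    unfolding eigenvalue_def eigenvector_def
    by (intro exI[of _ ?e]) (auto simp: carma_matrix_def)
qed

section \<open>Asymptotic normality for CARMA processes\<close>

theorem theorem3p5:
  fixes M :: "'a measure" and F :: "real \<Rightarrow> 'a measure" and L :: "real \<Rightarrow> 'a \<Rightarrow> real"
    and p q :: nat and \<alpha> \<beta> :: "nat \<Rightarrow> real"
    and X :: "real \<Rightarrow> 'a \<Rightarrow> real Matrix.vec" and Y :: "real \<Rightarrow> 'a \<Rightarrow> real"
    and \<sigma> :: real and a b :: "real poly" and Z :: "real \<Rightarrow> 'a \<Rightarrow> real"
  assumes carma: "carma_process M F L p q \<alpha> \<beta> X Y"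
    and a: "a = ar_poly p \<alpha>"
    and b: "b = ma_poly p \<beta>"
    and integrable: "integrable M (L 1)"
    and mean: "(LINT \<omega>|M. L 1 \<omega>) = 0"
    and square_integrable: "integrable M (\<lambda>\<omega>. \<bar>L 1 \<omega>\<bar>\<^sup>2)"
    and second_moment: "(LINT \<omega>|M. \<bar>L 1 \<omega>\<bar>\<^sup>2) = \<sigma>\<^sup>2"
    and stable: "\<And>z. eigenvalue (map_mat complex_of_real (carma_matrix p \<alpha>)) z \<Longrightarrow> Re z < 0"
    and Z: "Z = (\<lambda>T \<omega>. 1 / sqrt T * (poly b 0 / poly a 0) * integral_one L T \<omega>)"
  shows "converges_in_distribution M Z
           (normal_distribution 0 ((poly b 0 / poly a 0)\<^sup>2 * \<sigma>\<^sup>2)) at_top \<and>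
         (poly b 0 \<noteq> 0 \<and> \<sigma> \<noteq> 0 \<longrightarrow>
          converges_in_distribution M (\<lambda>T \<omega>. 1 / \<sigma>\<^sup>2 * \<bar>poly a 0 * Z T \<omega> / poly b 0\<bar>\<^sup>2)
            (chi_square_distribution 1) at_top)"
proof (intro conjI impI)
  interpret carma_process M F L p q \<alpha> \<beta> X Y by (fact carma)
  have moments: "integrable M (\<lambda>\<omega>. (L 1 \<omega>)\<^sup>2)" "expectation (\<lambda>\<omega>. (L 1 \<omega>)\<^sup>2) = \<sigma>\<^sup>2"
    using square_integrable second_moment by simp_all
  note clt = levy_central_limit_theorem[OF integrable mean moments]
  show "converges_in_distribution M Z
      (normal_distribution 0 ((poly b 0 / poly a 0)\<^sup>2 * \<sigma>\<^sup>2)) at_top"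
    unfolding Z by (rule clt)
  assume nz: "poly b 0 \<noteq> 0 \<and> \<sigma> \<noteq> 0"
  have "0 < p" using q_less_p by simp
  then have a0: "poly a 0 \<noteq> 0"
    using eigenvalue_carma_matrix_0 stable[of 0] by (auto simp: a poly_ar_poly_0)
  define W where "W T \<omega> = 1 / sqrt T * (1 / \<sigma>) * integral_one L T \<omega>" for T \<omega>
  have W: "1 / \<sigma>\<^sup>2 * \<bar>poly a 0 * Z T \<omega> / poly b 0\<bar>\<^sup>2 = (W T \<omega>)\<^sup>2" for T \<omega>
    using nz a0 by (simp add: Z W_def power_mult_distrib power_divide)
  have "converges_in_distribution M W (normal_distribution 0 1) at_top"
    using clt[of "1 / \<sigma>"] nz by (simp add: W_def[abs_def] power_divide)
  then show "converges_in_distribution M (\<lambda>T \<omega>. 1 / \<sigma>\<^sup>2 * \<bar>poly a 0 * Z T \<omega> / poly b 0\<bar>\<^sup>2)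
      (chi_square_distribution 1) at_top"
    unfolding W chi_square_distribution_1
  proof (rule converges_in_distribution_at_top_continuous_image[rotated 2])
    show "W T \<in> borel_measurable M" if "0 \<le> T" for T
      unfolding W_def[abs_def] using borel_measurable_integral_one[OF that] by simp
  qed (simp_all add: real_distribution_normal_distribution)
qed
end
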